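(* Let $c=(c_1,\dots,c_r)\in\mathbb{Z}_{\ge 0}^r$ with $r\geq 2$ and $\ell=c_1+\cdots+c_r\geq 1$. Let $I_c\subseteq\{1,2,\dots,r\}$ be the set with $i\in I_c$ if and only if $c_i>0$. For a subset $J\subseteq I_c$, define the composition $c(J)=(c_1(J),\dots,c_r(J))$ by $$c_i(J)=\begin{cases} c_i-1 & \text{if } i\in J \text{ and } (i-1)\notin J,\\ c_i+1 & \text{if } i\notin J \text{ and } (i-1)\in J,\\ c_i & \text{otherwise,}\end{cases}$$ where indices are read cyclically (the index $0$ is identified with $r$, so $c_0=c_r$). Then $$T_{c}(z,q)+\frac{zq^{r}}{1-zq^r}\,T_c(zq^r,q)=\sum_{\emptyset\neq J\subseteq I_c}(-1)^{|J|-1}\,\frac{T_{c(J)}(zq^{|J|},q)}{1-zq^{|J|}}.$$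
   Context: A partition is a weakly decreasing finite sequence of positive integers (its parts), extended by zeros beyond its last part. Given $c=(c_1,\dots,c_r)\in\mathbb{Z}_{\ge0}^r$, a cylindric partition of profile $c$ is an $r$-tuple of (possibly empty) partitions $\pi=(\pi^{(1)},\dots,\pi^{(r)})$ such that $\pi^{(i)}_j\ge \pi^{(i+1)}_{j+c_{i+1}}$ for all $1\le i\le r-1$, $j\ge1$, and $\pi^{(r)}_j\ge\pi^{(1)}_{j+c_1}$ for all $j\ge 1$. It is called tight if for every positive integer $j$ there is some $i\in\{1,\dots,r\}$ such that $\pi^{(i)}$ does not contain $j$ as a part. Let $\mathscr{T}_c$ be the set of tight cylindric partitions of profile $c$. Let $\max(\pi)$ be the largest part occurring in $\pi$ (equal to $0$ if all the $\pi^{(i)}$ are empty) and let $\mathrm{wt}(\pi)$ be the sum of all parts of all the $\pi^{(i)}$. Define $T_c(z,q)=\sum_{\pi\in\mathscr{T}_c}z^{\max(\pi)}q^{\mathrm{wt}(\pi)}$, a formal power series in $z,q$. *)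

theory Defs
  imports "HOL-Computational_Algebra.Formal_Power_Series"
begin

(* Everything is indexed from 0: the entries of a profile c = (c_1, ..., c_r) are
   c ! 0, ..., c ! (r - 1) with r = length c, the partitions of a tuple are numbered likewise,
   and the parts of a partition p are part p 0, part p 1, .... *)

definition is_partition :: "nat list \<Rightarrow> bool" where
  "is_partition p \<longleftrightarrow> sorted_wrt (\<ge>) p \<and> (\<forall>x\<in>set p. x > 0)"

definition part :: "nat list \<Rightarrow> nat \<Rightarrow> nat" where
  "part p j = (if j < length p then p ! j else 0)"

(* The index i = length c - 1 gives the wrap-around condition comparing the last partition
   with the first one. *)
definition cylindric :: "nat list \<Rightarrow> nat list list \<Rightarrow> bool" where
  "cylindric c \<pi> \<longleftrightarrow>
     length \<pi> = length c \<and> (\<forall>p\<in>set \<pi>. is_partition p) \<and>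
     (\<forall>i<length c. \<forall>j.
        part (\<pi> ! i) j \<ge>
        part (\<pi> ! (Suc i mod length c)) (j + c ! (Suc i mod length c)))"

definition tight :: "nat list list \<Rightarrow> bool" where
  "tight \<pi> \<longleftrightarrow> (\<forall>j>0. \<exists>i<length \<pi>. j \<notin> set (\<pi> ! i))"

definition tight_cylindric :: "nat list \<Rightarrow> nat list list set" where
  "tight_cylindric c = {\<pi>. cylindric c \<pi> \<and> tight \<pi>}"

definition max_part :: "nat list list \<Rightarrow> nat" where
  "max_part \<pi> = Max (insert 0 (\<Union>p\<in>set \<pi>. set p))"

definition wt :: "nat list list \<Rightarrow> nat" where
  "wt \<pi> = sum_list (map sum_list \<pi>)"

(* Power series in z and q are power series in z whose coefficients are power series in q.
   Rational coefficients make the library's division of power series available. *)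
abbreviation zvar :: "rat fps fps" where
  "zvar \<equiv> fps_X"

abbreviation qvar :: "rat fps fps" where
  "qvar \<equiv> fps_const fps_X"

(* T_c(z,q); the series T_c(z q^k, q) is T_gf c oo (zvar * qvar ^ k). *)
definition T_gf :: "nat list \<Rightarrow> rat fps fps" where
  "T_gf c = Abs_fps (\<lambda>n. Abs_fps (\<lambda>m.
     of_nat (card {\<pi> \<in> tight_cylindric c. max_part \<pi> = n \<and> wt \<pi> = m})))"

lemma length_le_sum_list:
  fixes p :: "nat list"
  assumes "\<forall>x\<in>set p. x > 0"
  shows "length p \<le> sum_list p"
  using assms by (induction p) (auto simp: Suc_le_eq)

(* The cardinalities in T_gf are those of finite sets. *)
lemma finite_tight_cylindric_wt: "finite {\<pi> \<in> tight_cylindric c. wt \<pi> = m}"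
proof (rule finite_subset)
  let ?P = "{p. set p \<subseteq> {..m} \<and> length p \<le> m}"
  show "{\<pi> \<in> tight_cylindric c. wt \<pi> = m} \<subseteq> {\<pi>. set \<pi> \<subseteq> ?P \<and> length \<pi> = length c}"
  proof clarsimp
    fix \<pi> p
    assume \<pi>: "\<pi> \<in> tight_cylindric c" "m = wt \<pi>"
    then have len: "length \<pi> = length c" and part: "\<And>p. p \<in> set \<pi> \<Longrightarrow> is_partition p"
      by (auto simp: tight_cylindric_def cylindric_def)
    have "set p \<subseteq> {..wt \<pi>} \<and> length p \<le> wt \<pi>" if p: "p \<in> set \<pi>" for p
    proof -
      have le: "sum_list p \<le> wt \<pi>"
        unfolding wt_def using p by (intro member_le_sum_list) auto
      have "length p \<le> sum_list p"
        using part[OF p] by (intro length_le_sum_list) (simp add: is_partition_def)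
      with le show ?thesis
        by (auto intro: order_trans[OF member_le_sum_list])
    qed
    with len show "set \<pi> \<subseteq> {p. set p \<subseteq> {..wt \<pi>} \<and> length p \<le> wt \<pi>} \<and> length \<pi> = length c"
      by auto
  qed
  have "finite ?P"
    by (rule finite_lists_length_le) simp
  then show "finite {\<pi>. set \<pi> \<subseteq> ?P \<and> length \<pi> = length c}"
    by (rule finite_lists_length_eq)
qed

definition supp :: "nat list \<Rightarrow> nat set" where
  "supp c = {i. i < length c \<and> c ! i > 0}"

definition cyc_pred :: "nat \<Rightarrow> nat \<Rightarrow> nat" where
  "cyc_pred r i = (if i = 0 then r - 1 else i - 1)"

(* c(J). The subtraction never truncates for J \<subseteq> supp c. *)
definition shift_profile :: "nat list \<Rightarrow> nat set \<Rightarrow> nat list" where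
  "shift_profile c J = map (\<lambda>i.
     if i \<in> J \<and> cyc_pred (length c) i \<notin> J then c ! i - 1
     else if i \<notin> J \<and> cyc_pred (length c) i \<in> J then c ! i + 1
     else c ! i) [0..<length c]"

end

theory Submission
  imports Defs
begin

text \<open>Compare the coefficients of \<open>z^M q^m\<close>, where \<open>M > 0\<close>. The term of \<open>J\<close> on the right counts tight
  cylindric partitions of profile \<open>c(J)\<close> with parts at most \<open>M\<close> and weight \<open>m - M |J|\<close>. Prepending
  the part \<open>M\<close> to the partitions indexed by \<open>J\<close> maps these bijectively to the cylindric partitions
  of profile \<open>c\<close> and weight \<open>m\<close> with parts at most \<open>M\<close>, tight below \<open>M\<close>, whose multiplicities \<open>v i\<close>
  of the part \<open>M\<close> satisfy \<open>v i \<ge> [i \<in> J]\<close> for all \<open>i\<close>, with equality for some \<open>i\<close>. The terms on the left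
  likewise count those with \<open>min v = 0 \<noteq> max v\<close> and those with \<open>v = 1\<close> throughout.
  For fixed \<open>v\<close>, the alternating sum over \<open>J\<close> collapses to these two cases because going around
  the cycle \<open>v\<close> can only increase at an index where \<open>c\<close> is positive.\<close>

unbundle fps_syntax

section \<open>Alternating sums over subsets\<close>

text \<open>Toggling membership of a fixed element \<open>a\<close> matches the subsets in pairs of
  opposite sign.\<close>

lemma sum_Pow_alternating:
  assumes "finite A" "A \<noteq> {}"
  shows "(\<Sum>J\<in>Pow A. (- 1) ^ card J) = (0::'a::comm_ring_1)"
proof -
  from assms obtain a where a: "a \<in> A" by blast
  define B where "B = A - {a}"
  have B: "A = insert a B" "a \<notin> B" "finite B"
    using a assms by (auto simp: B_def)
  have "(\<Sum>J\<in>Pow A. (- 1) ^ card J) =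
      (\<Sum>J\<in>Pow B. (- 1) ^ card J) + (\<Sum>J\<in>insert a ` Pow B. (- 1 :: 'a) ^ card J)"
    unfolding B(1) Pow_insert using B by (intro sum.union_disjoint) auto
  also have "(\<Sum>J\<in>insert a ` Pow B. (- 1 :: 'a) ^ card J) = (\<Sum>J\<in>Pow B. (- 1) ^ card (insert a J))"
    using B by (subst sum.reindex) (auto simp: inj_on_def)
  also have "\<dots> = (\<Sum>J\<in>Pow B. - ((- 1) ^ card J))"
    using B by (intro sum.cong refl) (auto simp: card_insert_if finite_subset)
  finally show ?thesis
    by (simp add: sum_negf)
qed

text \<open>The exponent \<open>card J - 1\<close> reverses all signs of the vanishing full sum;
  removing the empty set leaves 1.\<close>

lemma sum_nonempty_subsets_alternating:
  assumes "finite A"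
  shows "(\<Sum>J | J \<noteq> {} \<and> J \<subseteq> A. (- 1) ^ (card J - 1)) = (of_bool (A \<noteq> {}) :: 'a::comm_ring_1)"
proof (cases "A = {}")
  case True
  then show ?thesis
    by (auto intro!: sum.neutral)
next
  case False
  have "(\<Sum>J | J \<noteq> {} \<and> J \<subseteq> A. (- 1) ^ (card J - 1)) = (\<Sum>J\<in>Pow A - {{}}. - ((- 1 :: 'a) ^ card J))"
  proof (rule sum.cong)
    fix J assume "J \<in> Pow A - {{}}"
    then have "card J > 0"
      using assms by (auto simp: card_gt_0_iff finite_subset)
    then show "(- 1) ^ (card J - 1) = - ((- 1 :: 'a) ^ card J)"
      by (cases "card J") auto
  qed auto
  also have "\<dots> = - ((\<Sum>J\<in>Pow A. (- 1) ^ card J) - 1)"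
    using assms by (simp add: sum_negf sum_diff1)
  finally show ?thesis
    using sum_Pow_alternating[OF assms False, where 'a = 'a] False by simp
qed

text \<open>Below, \<open>v i\<close> is the multiplicity of the part \<open>M\<close> in the \<open>i\<close>-th partition and \<open>S\<close> is
  the support of the profile.\<close>

lemma boundary_alternating_sum:
  fixes v :: "nat \<Rightarrow> nat"
  assumes "r > 0" and S: "S \<subseteq> {..<r}" "S \<noteq> {}"
    and rise: "\<And>a i k. \<lbrakk>i < r; v i = a; k < r; v k > a; \<And>j. j < r \<Longrightarrow> v j \<ge> a\<rbrakk> \<Longrightarrow> \<exists>j\<in>S. v j > a"
  shows "(\<Sum>J | J \<noteq> {} \<and> J \<subseteq> S. (- 1) ^ (card J - 1) *
            of_bool ((\<forall>i\<in>J. v i > 0) \<and> (\<exists>i<r. v i = of_bool (i \<in> J)))) =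
         (of_bool ((\<exists>i<r. v i = 0) \<and> (\<exists>i<r. v i > 0)) + of_bool (\<forall>i<r. v i = 1) :: 'a::comm_ring_1)"
    (is "?lhs = ?rhs")
proof -
  let ?Q = "\<lambda>J. (\<forall>i\<in>J. v i > 0) \<and> (\<exists>i<r. v i = of_bool (i \<in> J))"
  let ?s = "\<lambda>J::nat set. (- 1 :: 'a) ^ (card J - 1)"
  have fin: "finite S"
    using S finite_subset by blast
  have finsub: "finite {J. J \<noteq> {} \<and> J \<subseteq> B}" if "finite B" for B :: "nat set"
    by (rule finite_subset[of _ "Pow B"]) (use that in auto)
  have lhs: "?lhs = (\<Sum>J | J \<noteq> {} \<and> J \<subseteq> S \<and> ?Q J. ?s J)"
    by (rule sum.mono_neutral_cong_right) (use finsub[OF fin] in auto)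
  show ?thesis
  proof (cases "\<exists>i<r. v i = 0")
    case True
    then obtain k where k: "k < r" "v k = 0" by blast
    \<comment> \<open>The index \<open>k\<close> belongs to no \<open>J\<close> with positive
      multiplicities, so it witnesses the equality; only positivity on \<open>J\<close>
      remains.\<close>
    have "?lhs = (\<Sum>J | J \<noteq> {} \<and> J \<subseteq> {i\<in>S. v i > 0}. ?s J)"
      unfolding lhs
    proof (rule sum.cong)
      have "?Q J \<longleftrightarrow> (\<forall>i\<in>J. v i > 0)" for J
        using k by (cases "k \<in> J") (auto intro!: exI[of _ k])
      then show "{J. J \<noteq> {} \<and> J \<subseteq> S \<and> ?Q J} = {J. J \<noteq> {} \<and> J \<subseteq> {i \<in> S. 0 < v i}}"
        by (simp add: subset_iff) blast
    qed simp
    also have "\<dots> = of_bool ({i\<in>S. v i > 0} \<noteq> {})"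
      using fin by (intro sum_nonempty_subsets_alternating) auto
    also have "{i\<in>S. v i > 0} \<noteq> {} \<longleftrightarrow> (\<exists>i<r. v i > 0)"
    proof
      assume "\<exists>i<r. v i > 0"
      then obtain j where "j < r" "v j > 0" by blast
      from rise[OF k this] show "{i\<in>S. v i > 0} \<noteq> {}" by auto
    qed (use S in auto)
    finally show ?thesis
      using True by auto
  next
    case False
    then have pos: "v i > 0" if "i < r" for i
      using that by auto
    let ?D = "{i\<in>S. v i > 1}"
    \<comment> \<open>With all multiplicities positive, the equality can only mean
      \<open>v i = 1\<close> for some \<open>i \<in> J\<close>. It fails exactly for the subsets of
      \<open>?D\<close>, so the sum is a difference of two full alternating sums.\<close>
    have "(\<Sum>J | J \<noteq> {} \<and> J \<subseteq> S. ?s J) = ?lhs + (\<Sum>J | J \<noteq> {} \<and> J \<subseteq> ?D. ?s J)"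
      unfolding lhs
    proof (subst sum.union_disjoint [symmetric])
      have Q: "?Q J \<longleftrightarrow> \<not> J \<subseteq> ?D" if "J \<subseteq> S" for J
      proof -
        have "?Q J \<longleftrightarrow> (\<exists>i\<in>J. v i = 1)"
        proof
          assume "?Q J"
          then obtain i where "i < r" "v i = of_bool (i \<in> J)" by blast
          with pos[of i] show "\<exists>i\<in>J. v i = 1" by (cases "i \<in> J") auto
        next
          assume "\<exists>i\<in>J. v i = 1"
          then obtain i where "i \<in> J" "v i = 1" by blast
          with that S pos show "?Q J" by (auto intro!: exI[of _ i])
        qed
        moreover have "v i > 1 \<longleftrightarrow> v i \<noteq> 1" if "i \<in> S" for i
          using that S pos[of i] by auto
        ultimately show ?thesis
          using that by auto
      qed
      have "{J. J \<noteq> {} \<and> J \<subseteq> S} = {J. J \<noteq> {} \<and> J \<subseteq> S \<and> ?Q J} \<union> {J. J \<noteq> {} \<and> J \<subseteq> ?D}"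
        using Q by (simp cong: conj_cong) blast
      then show "sum ?s {J. J \<noteq> {} \<and> J \<subseteq> S} =
          sum ?s ({J. J \<noteq> {} \<and> J \<subseteq> S \<and> ?Q J} \<union> {J. J \<noteq> {} \<and> J \<subseteq> ?D})"
        by (rule arg_cong)
      show "{J. J \<noteq> {} \<and> J \<subseteq> S \<and> ?Q J} \<inter> {J. J \<noteq> {} \<and> J \<subseteq> ?D} = {}"
        using Q by (simp add: disjoint_iff cong: conj_cong)
    next
      show "finite {J. J \<noteq> {} \<and> J \<subseteq> S \<and> ?Q J}"
        by (rule finite_subset[OF _ finsub[OF fin]]) auto
    qed (use finsub fin in auto)
    then have "?lhs = of_bool (S \<noteq> {}) - of_bool (?D \<noteq> {})"
      using sum_nonempty_subsets_alternating[of S, where 'a = 'a]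
        sum_nonempty_subsets_alternating[of ?D, where 'a = 'a] fin by (simp add: algebra_simps)
    also have "\<dots> = of_bool (\<forall>i<r. v i = 1)"
    proof (cases "\<forall>i<r. v i = 1")
      case True
      then show ?thesis using S by force
    next
      case ne: False
      then obtain k where k: "k < r" "v k > 1"
        using pos by (metis One_nat_def Suc_lessI)
      have "?D \<noteq> {}"
      \<comment> \<open>If the value 1 occurs, it is the minimum and \<open>rise\<close> applies
        with \<open>a = 1\<close>; otherwise all of \<open>S\<close> lies above 1.\<close>
      proof (cases "\<exists>i<r. v i = 1")
        case True
        then obtain i where "i < r" "v i = 1" by blast
        from rise[OF this k] pos show ?thesis by (auto simp: Suc_le_eq)
      next
        case False
        then have "v i > 1" if "i \<in> S" for i
          using that S pos[of i] by (metis One_nat_def Suc_lessI lessThan_iff subsetD)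
        then have "?D = S" by auto
        then show ?thesis using S by simp
      qed
      then show ?thesis using ne S by (simp only: of_bool_def) simp
    qed
    finally show ?thesis
      using False by auto
  qed
qed

section \<open>Rises along a cycle\<close>

lemma Suc_mod_less: "i < r \<Longrightarrow> Suc i mod r < r"
  by (rule mod_less_divisor) linarith

text \<open>A discrete intermediate value argument: without such a step, failure of \<open>P\<close>
  would spread from \<open>k\<close> all the way around to \<open>i\<close>.\<close>

lemma cyclic_rise:
  assumes "i < r" "P i" "k < r" "\<not> P k"
  shows "\<exists>j<r. \<not> P j \<and> P (Suc j mod r)"
proof (rule ccontr)
  assume no: "\<not> ?thesis"
  have "\<not> P ((k + n) mod r)" for n
  proof (induction n)
    case (Suc n)
    have "(k + n) mod r < r" using assms by simp
    with Suc no have "\<not> P (Suc ((k + n) mod r) mod r)" by blast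
    then show ?case by (simp add: mod_Suc_eq)
  qed (use assms in simp)
  \<comment> \<open>Since \<open>k < r\<close>, this many steps lead from \<open>k\<close> to
    \<open>i\<close> modulo \<open>r\<close>.\<close>
  from this[of "i + r - k"] show False
    using assms by simp
qed

section \<open>Inserting a largest part\<close>

text \<open>Since \<open>M\<close> bounds all parts, its copies form an initial run, whose length is
  the multiplicity. \<open>M > 0\<close> keeps the padding zeros out.\<close>

lemma count_list_partition:
  assumes "is_partition p" "\<forall>x\<in>set p. x \<le> M" "M > 0"
  shows "j < count_list p M \<longleftrightarrow> part p j = M"
  using assms
proof (induction p arbitrary: j)
  case Nil
  then show ?case by (simp add: part_def)
next
  case (Cons x p)
  then have IH: "j < count_list p M \<longleftrightarrow> part p j = M" for j
    by (simp add: is_partition_def)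
  show ?case
  proof (cases "x = M")
    case True
    then show ?thesis
      using IH by (cases j) (auto simp: part_def)
  next
    case False
    then have "\<forall>y\<in>set (x # p). y < M"
      using Cons.prems by (auto simp: is_partition_def)
    then have "part (x # p) j \<noteq> M"
      using Cons.prems(3) nth_mem[of j "x # p"] by (auto simp: part_def simp del: nth_mem)
    moreover have "count_list (x # p) M = 0"
      using \<open>\<forall>y\<in>set (x # p). y < M\<close> by (subst count_list_0_iff) auto
    ultimately show ?thesis by simp
  qed
qed

lemma part_le:
  assumes "\<forall>x\<in>set p. x \<le> M"
  shows "part p j \<le> M"
  using assms by (simp add: part_def)

lemma part_Cons: "part (x # p) j = (if j = 0 then x else part p (j - 1))"
  by (cases j) (auto simp: part_def)

definition bounded_parts :: "nat \<Rightarrow> nat list list \<Rightarrow> bool" where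
  "bounded_parts M \<pi> \<longleftrightarrow> (\<forall>p\<in>set \<pi>. \<forall>x\<in>set p. x \<le> M)"

lemma ball_set_conv_nth: "(\<forall>p\<in>set \<pi>. P p) \<longleftrightarrow> (\<forall>i<length \<pi>. P (\<pi> ! i))"
  by (metis in_set_conv_nth)

lemma bex_set_conv_nth: "(\<exists>p\<in>set \<pi>. P p) \<longleftrightarrow> (\<exists>i<length \<pi>. P (\<pi> ! i))"
  by (metis in_set_conv_nth)

lemma bounded_parts_conv_nth:
  "bounded_parts M \<pi> \<longleftrightarrow> (\<forall>i<length \<pi>. \<forall>x\<in>set (\<pi> ! i). x \<le> M)"
  unfolding bounded_parts_def by (rule ball_set_conv_nth)

lemma cylindric_is_partition: "cylindric c \<pi> \<Longrightarrow> i < length c \<Longrightarrow> is_partition (\<pi> ! i)"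
  by (simp add: cylindric_def)

definition insert_part :: "nat \<Rightarrow> nat set \<Rightarrow> nat list list \<Rightarrow> nat list list" where
  "insert_part M J \<sigma> = map (\<lambda>i. if i \<in> J then M # \<sigma> ! i else \<sigma> ! i) [0..<length \<sigma>]"

lemma length_insert_part [simp]: "length (insert_part M J \<sigma>) = length \<sigma>"
  by (simp add: insert_part_def)

lemma nth_insert_part [simp]:
  "i < length \<sigma> \<Longrightarrow> insert_part M J \<sigma> ! i = (if i \<in> J then M # \<sigma> ! i else \<sigma> ! i)"
  by (simp add: insert_part_def)

lemma inj_insert_part: "inj (insert_part M J)"
proof (rule injI)
  fix \<sigma> \<tau> assume eq: "insert_part M J \<sigma> = insert_part M J \<tau>"
  then have len: "length \<sigma> = length \<tau>"
    by (metis length_insert_part)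
  show "\<sigma> = \<tau>"
  proof (rule nth_equalityI)
    fix i assume i: "i < length \<sigma>"
    with len eq have "insert_part M J \<sigma> ! i = insert_part M J \<tau> ! i" by simp
    with i len show "\<sigma> ! i = \<tau> ! i" by (auto split: if_splits)
  qed (rule len)
qed

lemma bounded_insert_part [simp]: "bounded_parts M (insert_part M J \<sigma>) \<longleftrightarrow> bounded_parts M \<sigma>"
  by (auto simp: bounded_parts_conv_nth)

lemma wt_insert_part:
  assumes "J \<subseteq> {..<length \<sigma>}"
  shows "wt (insert_part M J \<sigma>) = wt \<sigma> + M * card J"
proof -
  have "wt (insert_part M J \<sigma>) = (\<Sum>i<length \<sigma>. sum_list (\<sigma> ! i) + (if i \<in> J then M else 0))"
    by (simp add: wt_def insert_part_def interv_sum_list_conv_sum_set_nat atLeast0LessThan o_def if_distrib add.commute cong: if_cong)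
  also have "\<dots> = wt \<sigma> + (\<Sum>i\<in>{..<length \<sigma>} \<inter> J. M)"
    unfolding sum.distrib by (subst sum.inter_restrict) (simp_all add: wt_def sum_list_sum_nth atLeast0LessThan)
  also have "{..<length \<sigma>} \<inter> J = J"
    using assms by auto
  finally show ?thesis by simp
qed

lemma cyc_pred_Suc_mod: "i < r \<Longrightarrow> cyc_pred r (Suc i mod r) = i"
  by (cases "Suc i = r") (auto simp: cyc_pred_def)

lemma length_shift_profile [simp]: "length (shift_profile c J) = length c"
  by (simp add: shift_profile_def)

text \<open>This lets the second term on the left be treated by the same insertion argument, with
  the full index set as \<open>J\<close>.\<close>

lemma shift_profile_full: "shift_profile c {..<length c} = c"
  by (rule nth_equalityI) (auto simp: shift_profile_def cyc_pred_def)

text \<open>The hypothesis on \<open>J\<close> covers both the subsets of the support and the full index set.\<close>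

lemma cylindric_insert_part:
  assumes M: "M > 0" and bd: "bounded_parts M \<sigma>"
    and J: "\<And>i. i < length c \<Longrightarrow> i \<in> J \<Longrightarrow> cyc_pred (length c) i \<notin> J \<Longrightarrow> c ! i > 0"
  shows "cylindric c (insert_part M J \<sigma>) \<longleftrightarrow> cylindric (shift_profile c J) \<sigma>"
proof (cases "length \<sigma> = length c")
  case len: True
  let ?r = "length c"
  have le: "x \<le> M" if "i < ?r" "x \<in> set (\<sigma> ! i)" for i x
    using that bd len by (auto simp: bounded_parts_conv_nth)
  have part: "is_partition (insert_part M J \<sigma> ! i) \<longleftrightarrow> is_partition (\<sigma> ! i)" if "i < ?r" for i
    using that len M le[OF that] by (auto simp: is_partition_def)
  have "(\<forall>j. part (insert_part M J \<sigma> ! (Suc i mod ?r)) (j + c ! (Suc i mod ?r)) \<le>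
              part (insert_part M J \<sigma> ! i) j) \<longleftrightarrow>
        (\<forall>j. part (\<sigma> ! (Suc i mod ?r)) (j + shift_profile c J ! (Suc i mod ?r)) \<le>
              part (\<sigma> ! i) j)" (is "(\<forall>j. ?L j) \<longleftrightarrow> (\<forall>j. ?R j)") if i: "i < ?r" for i
  proof -
    define k where "k = Suc i mod ?r"
    have k: "k < ?r" "cyc_pred ?r k = i"
      using cyc_pred_Suc_mod[OF i] Suc_mod_less[OF i] by (auto simp: k_def)
    have sh: "shift_profile c J ! k =
        (if k \<in> J \<and> i \<notin> J then c ! k - 1 else if k \<notin> J \<and> i \<in> J then c ! k + 1 else c ! k)"
      using k by (simp add: shift_profile_def)
    have pM: "part (\<sigma> ! k) j \<le> M" for j
      using le[OF k(1)] by (intro part_le) auto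
    have all0: "(\<forall>j. P j) \<longleftrightarrow> P 0 \<and> (\<forall>j. P (Suc j))" for P :: "nat \<Rightarrow> bool"
      by (metis not0_implies_Suc)
    \<comment> \<open>For \<open>i \<in> J\<close> the inequality at position 0 has \<open>M\<close>
      on its larger side and holds anyway; the others are those of \<open>\<sigma>\<close> moved by
      one. For \<open>i \<notin> J\<close> and \<open>k \<in> J\<close> the offset drops by one,
      exactly since \<open>c ! k > 0\<close>.\<close>
    show ?thesis
    proof (cases "i \<in> J")
      case True
      have "?L 0" "?L (Suc j) \<longleftrightarrow> ?R j" for j
        using True i k len sh pM unfolding k_def[symmetric] by (auto simp: part_Cons)
      then show ?thesis using all0[of ?L] by simp
    next
      case False
      have "?L j \<longleftrightarrow> ?R j" for j
        using False i k len sh J[OF k(1)] unfolding k_def[symmetric] by (auto simp: part_Cons)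
      then show ?thesis by simp
    qed
  qed
  then show ?thesis
    using len part by (simp add: cylindric_def ball_set_conv_nth)
qed (simp add: cylindric_def)

section \<open>Counting configurations\<close>

text \<open>The common universe of the configurations on both sides. Tightness is not asked at level
  \<open>M\<close>, the only level that inserting or removing \<open>M\<close> affects.\<close>

definition semi_tight :: "nat list \<Rightarrow> nat \<Rightarrow> nat \<Rightarrow> nat list list set" where
  "semi_tight c M m = {\<pi>. cylindric c \<pi> \<and> bounded_parts M \<pi> \<and> wt \<pi> = m \<and>
     (\<forall>j. 0 < j \<longrightarrow> j < M \<longrightarrow> (\<exists>i<length c. j \<notin> set (\<pi> ! i)))}"

lemma max_part_le_iff: "max_part \<pi> \<le> M \<longleftrightarrow> bounded_parts M \<pi>"
  by (auto simp: max_part_def bounded_parts_def)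

lemma tight_bounded_iff:
  assumes "bounded_parts M \<pi>" "M > 0" "length \<pi> > 0"
  shows "tight \<pi> \<longleftrightarrow> (\<forall>j. 0 < j \<longrightarrow> j < M \<longrightarrow> (\<exists>i<length \<pi>. j \<notin> set (\<pi> ! i))) \<and>
    (\<exists>i<length \<pi>. M \<notin> set (\<pi> ! i))" (is "_ \<longleftrightarrow> ?R \<and> ?E")
proof
  assume "?R \<and> ?E"
  \<comment> \<open>Levels above \<open>M\<close> occur nowhere; index 0 exists because the tuple is
    nonempty.\<close>
  moreover have "j \<notin> set (\<pi> ! 0)" if "j > M" for j
    using assms that by (fastforce simp: bounded_parts_conv_nth)
  ultimately show "tight \<pi>"
    unfolding tight_def using assms by (metis nat_neq_iff)
qed (use assms in \<open>auto simp: tight_def\<close>)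

lemma max_part_eq_iff:
  assumes "M > 0"
  shows "max_part \<pi> = M \<longleftrightarrow> bounded_parts M \<pi> \<and> (\<exists>i<length \<pi>. M \<in> set (\<pi> ! i))"
proof -
  let ?A = "insert 0 (\<Union>p\<in>set \<pi>. set p)"
  have "max_part \<pi> = M \<longleftrightarrow> M \<in> ?A \<and> (\<forall>x\<in>?A. x \<le> M)"
    unfolding max_part_def by (rule Max_eq_iff) auto
  also have "\<dots> \<longleftrightarrow> bounded_parts M \<pi> \<and> (\<exists>i<length \<pi>. M \<in> set (\<pi> ! i))"
    using assms bex_set_conv_nth[of \<pi> "\<lambda>p. M \<in> set p"] by (auto simp: bounded_parts_def)
  finally show ?thesis .
qed

lemma count_list_pos_iff: "0 < count_list xs x \<longleftrightarrow> x \<in> set xs"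
  using count_list_0_iff[of xs x] by auto

lemma tight_max_eq:
  assumes "M > 0" "length c > 0"
  shows "{\<pi> \<in> tight_cylindric c. max_part \<pi> = M \<and> wt \<pi> = m} =
    {\<pi> \<in> semi_tight c M m. (\<exists>i<length c. count_list (\<pi> ! i) M = 0) \<and>
       (\<exists>i<length c. count_list (\<pi> ! i) M > 0)}"
proof -
  have "length \<pi> = length c" if "cylindric c \<pi>" for \<pi>
    using that by (simp add: cylindric_def)
  then show ?thesis
    using assms
    by (auto simp: tight_cylindric_def semi_tight_def max_part_eq_iff tight_bounded_iff
        count_list_0_iff count_list_pos_iff)
qed

text \<open>Insertion raises the multiplicity of \<open>M\<close> by one on \<open>J\<close> only,
  so equality with \<open>of_bool (i \<in> J)\<close> at some \<open>i\<close> is tightness of the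
  original tuple at level \<open>M\<close>. Conversely, a positive multiplicity means that
  \<open>M\<close> is the first part and can be removed.\<close>

lemma insert_part_image:
  assumes M: "M > 0" and c: "length c > 0" and J: "J \<subseteq> {..<length c}"
    and pos: "\<And>i. i < length c \<Longrightarrow> i \<in> J \<Longrightarrow> cyc_pred (length c) i \<notin> J \<Longrightarrow> c ! i > 0"
  shows "insert_part M J ` {\<sigma> \<in> tight_cylindric (shift_profile c J).
           max_part \<sigma> \<le> M \<and> wt \<sigma> + M * card J = m} =
    {\<pi> \<in> semi_tight c M m. (\<forall>i\<in>J. count_list (\<pi> ! i) M > 0) \<and>
       (\<exists>i<length c. count_list (\<pi> ! i) M = of_bool (i \<in> J))}" (is "_ ` ?A = ?B")
proof -
  let ?r = "length c"
  have key: "\<sigma> \<in> ?A \<longleftrightarrow> insert_part M J \<sigma> \<in> ?B" for \<sigma>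
  proof (cases "length \<sigma> = ?r \<and> bounded_parts M \<sigma>")
    case True
    then have len: "length \<sigma> = ?r" and bd: "bounded_parts M \<sigma>" by auto
    have mem: "j \<in> set (insert_part M J \<sigma> ! i) \<longleftrightarrow> j \<in> set (\<sigma> ! i)" if "i < ?r" "j < M" for i j
      using that len by auto
    have cnt: "count_list (insert_part M J \<sigma> ! i) M = of_bool (i \<in> J) + count_list (\<sigma> ! i) M"
      if "i < ?r" for i
      using that len by simp
    have "tight \<sigma> \<longleftrightarrow>
        (\<forall>j. 0 < j \<longrightarrow> j < M \<longrightarrow> (\<exists>i<?r. j \<notin> set (insert_part M J \<sigma> ! i))) \<and>
        (\<exists>i<?r. count_list (insert_part M J \<sigma> ! i) M = of_bool (i \<in> J))"
      using tight_bounded_iff[OF bd M] len c cnt mem by (simp add: count_list_0_iff cong: conj_cong)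
    moreover have "\<forall>i\<in>J. count_list (insert_part M J \<sigma> ! i) M > 0"
      using cnt J by auto
    ultimately show ?thesis
      using bd cylindric_insert_part[OF M bd pos] wt_insert_part[of J \<sigma> M] J len
      by (auto simp: tight_cylindric_def semi_tight_def max_part_le_iff)
  next
    case False
    then show ?thesis
      by (auto simp: tight_cylindric_def semi_tight_def max_part_le_iff cylindric_def)
  qed
  \<comment> \<open>\<open>key\<close> concerns only tuples of the form
    \<open>insert_part M J \<sigma>\<close>; that all of \<open>?B\<close> has this form comes from
    stripping the leading \<open>M\<close>.\<close>
  moreover have "\<pi> \<in> range (insert_part M J)" if "\<pi> \<in> ?B" for \<pi>
  proof -
    have len: "length \<pi> = ?r" and bd: "bounded_parts M \<pi>"
      and part: "\<forall>i<?r. is_partition (\<pi> ! i)"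
      and cnt: "\<forall>i\<in>J. count_list (\<pi> ! i) M > 0"
      using that by (auto simp: semi_tight_def cylindric_def ball_set_conv_nth)
    have Cons: "\<pi> ! i = M # tl (\<pi> ! i)" if i: "i \<in> J" for i
    proof -
      have "part (\<pi> ! i) 0 = M"
        using count_list_partition[of "\<pi> ! i" M 0] part cnt i J bd len M
        by (auto simp: bounded_parts_conv_nth)
      then show ?thesis
        using M by (cases "\<pi> ! i") (auto simp: part_def)
    qed
    have "\<pi> = insert_part M J (map (\<lambda>i. if i \<in> J then tl (\<pi> ! i) else \<pi> ! i) [0..<?r])"
      using len Cons by (intro nth_equalityI) auto
    then show ?thesis by blast
  qed
  ultimately show ?thesis by blast
qed

section \<open>Multiplicities of the largest part around the cycle\<close>

text \<open>At offset 0 the cylindric inequality compares equal positions, so each \<open>M\<close>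
  in a partition forces an \<open>M\<close> at the same position of its cyclic predecessor.\<close>

lemma count_list_cyclic_le:
  assumes cyl: "cylindric c \<pi>" and bd: "bounded_parts M \<pi>" and M: "M > 0"
    and i: "i < length c" and c: "c ! (Suc i mod length c) = 0"
  shows "count_list (\<pi> ! (Suc i mod length c)) M \<le> count_list (\<pi> ! i) M"
proof (rule ccontr)
  define k where "k = Suc i mod length c"
  assume "\<not> ?thesis"
  then have less: "count_list (\<pi> ! i) M < count_list (\<pi> ! k) M"
    by (simp add: k_def)
  have k: "k < length c" "c ! k = 0"
    using c Suc_mod_less[OF i] by (auto simp: k_def)
  have p: "is_partition (\<pi> ! j)" "\<forall>x\<in>set (\<pi> ! j). x \<le> M" if "j < length c" for j
    using that cyl bd by (auto simp: cylindric_def bounded_parts_conv_nth)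
  have "part (\<pi> ! k) (count_list (\<pi> ! i) M) = M"
    using less count_list_partition[OF p[OF k(1)] M] by simp
  moreover have "part (\<pi> ! k) (count_list (\<pi> ! i) M + c ! k) \<le> part (\<pi> ! i) (count_list (\<pi> ! i) M)"
    using cyl i unfolding cylindric_def k_def by blast
  ultimately have "part (\<pi> ! i) (count_list (\<pi> ! i) M) = M"
    using k part_le[OF p(2)[OF i]] by (metis add_0_right le_antisym)
  then show False
    using count_list_partition[OF p[OF i] M, of "count_list (\<pi> ! i) M"] by simp
qed

text \<open>Supplies the hypothesis \<open>rise\<close> of \<open>boundary_alternating_sum\<close>:
  some step around the cycle climbs above \<open>a\<close>, and by
  \<open>count_list_cyclic_le\<close> it enters an index with positive offset.\<close>

lemma count_list_rise:
  assumes \<pi>: "\<pi> \<in> semi_tight c M m" and M: "M > 0"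
    and "i < length c" "count_list (\<pi> ! i) M = a" "k < length c" "count_list (\<pi> ! k) M > a"
    and ge: "\<And>i. i < length c \<Longrightarrow> count_list (\<pi> ! i) M \<ge> a"
  shows "\<exists>i\<in>supp c. count_list (\<pi> ! i) M > a"
proof -
  obtain j where j: "j < length c" "\<not> count_list (\<pi> ! j) M > a"
      "count_list (\<pi> ! (Suc j mod length c)) M > a"
    using cyclic_rise[of k "length c" "\<lambda>i. count_list (\<pi> ! i) M > a" i] assms by auto
  moreover have "c ! (Suc j mod length c) \<noteq> 0"
    using count_list_cyclic_le[of c \<pi> M j] \<pi> j M by (auto simp: semi_tight_def)
  moreover have "Suc j mod length c < length c"
    by (rule Suc_mod_less[OF j(1)])
  ultimately show ?thesis
    by (auto simp: supp_def)
qed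

lemma finite_tight_cylindric_shifted: "finite {\<sigma> \<in> tight_cylindric c. P \<sigma> \<and> wt \<sigma> + k = (m::nat)}"
  by (rule finite_subset[OF _ finite_tight_cylindric_wt[of c "m - k"]]) auto

lemma supp_nonempty:
  assumes "sum_list c \<ge> 1"
  shows "supp c \<noteq> {}"
proof -
  from assms have "\<exists>x\<in>set c. x > 0"
    using sum_list_eq_0_iff[of c] by (metis gr0I not_one_le_zero)
  then show ?thesis
    unfolding bex_set_conv_nth by (auto simp: supp_def)
qed

section \<open>The coefficient identity for positive \<open>M\<close>\<close>

text \<open>Indicator sums over one finite set allow the summations over \<open>\<pi>\<close> and
  \<open>J\<close> to be interchanged.\<close>

lemma card_eq_sum_of_bool:
  assumes "finite Y" "A \<subseteq> Y"
  shows "(of_nat (card A) :: 'a::comm_ring_1) = (\<Sum>\<pi>\<in>Y. of_bool (\<pi> \<in> A))"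
  using assms by (simp add: Int_absorb1)

text \<open>All counted sets are placed in one finite set, by insertion where necessary; there the
  identity holds tuple by tuple by \<open>boundary_alternating_sum\<close>.\<close>

lemma card_identity:
  assumes M: "M > 0" and sum: "sum_list c \<ge> 1"
  shows "of_nat (card {\<pi> \<in> tight_cylindric c. max_part \<pi> = M \<and> wt \<pi> = m}) +
      of_nat (card {\<sigma> \<in> tight_cylindric c. max_part \<sigma> < M \<and> wt \<sigma> + M * length c = m}) =
    (\<Sum>J | J \<noteq> {} \<and> J \<subseteq> supp c. (- 1) ^ (card J - 1) *
      (of_nat (card {\<sigma> \<in> tight_cylindric (shift_profile c J).
         max_part \<sigma> \<le> M \<and> wt \<sigma> + M * card J = m}) :: 'a::comm_ring_1))"
proof -
  let ?r = "length c"
  let ?v = "\<lambda>\<pi> i. count_list (\<pi> ! i) M"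
  define A where "A = {\<pi> \<in> tight_cylindric c. max_part \<pi> = M \<and> wt \<pi> = m}"
  define T where "T J = {\<sigma> \<in> tight_cylindric (shift_profile c J).
         max_part \<sigma> \<le> M \<and> wt \<sigma> + M * card J = m}" for J
  define T' where "T' = {\<sigma> \<in> tight_cylindric c. max_part \<sigma> < M \<and> wt \<sigma> + M * ?r = m}"
  define B where "B = insert_part M {..<?r} ` T'"
  define C where "C J = insert_part M J ` T J" for J
  have supp: "supp c \<noteq> {}" "supp c \<subseteq> {..<?r}"
    using supp_nonempty[OF sum] by (auto simp: supp_def)
  then have r: "?r > 0" by auto
  \<comment> \<open>On subsets of the support the offsets are positive; for the full index set every
    cyclic predecessor lies in \<open>J\<close>.\<close>
  have C: "C J = {\<pi> \<in> semi_tight c M m. (\<forall>i\<in>J. ?v \<pi> i > 0) \<and> (\<exists>i<?r. ?v \<pi> i = of_bool (i \<in> J))}"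
    if "J \<subseteq> supp c \<or> J = {..<?r}" for J
    unfolding C_def T_def using that supp r
    by (intro insert_part_image M) (auto simp: supp_def cyc_pred_def)
  have A: "A = {\<pi> \<in> semi_tight c M m. (\<exists>i<?r. ?v \<pi> i = 0) \<and> (\<exists>i<?r. ?v \<pi> i > 0)}"
    unfolding A_def by (rule tight_max_eq[OF M r])
  \<comment> \<open>Strictly below \<open>M\<close> means at most \<open>M\<close> without any copy
    of \<open>M\<close>; the full index set has \<open>c\<close> as shifted profile and
    \<open>?r\<close> elements.\<close>
  have T': "T' = {\<sigma> \<in> T {..<?r}. \<forall>i<?r. ?v \<sigma> i = 0}"
  proof -
    have "max_part \<sigma> < M \<longleftrightarrow> max_part \<sigma> \<le> M \<and> (\<forall>i<?r. ?v \<sigma> i = 0)" if "\<sigma> \<in> tight_cylindric c" for \<sigma>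
      using that max_part_eq_iff[OF M, of \<sigma>] max_part_le_iff[of \<sigma> M]
      by (auto simp: tight_cylindric_def cylindric_def count_list_0_iff order.strict_iff_order)
    then show ?thesis
      by (auto simp: T'_def T_def shift_profile_full)
  qed
  have len: "length \<sigma> = ?r" if "\<sigma> \<in> T J" for \<sigma> J
    using that by (simp add: T_def tight_cylindric_def cylindric_def)
  have "B = {\<pi> \<in> C {..<?r}. \<forall>i<?r. ?v \<pi> i = 1}"
    unfolding B_def T' C_def using len by auto
  then have B: "B = {\<pi> \<in> semi_tight c M m. \<forall>i<?r. ?v \<pi> i = 1}"
    using C[of "{..<?r}"] r by auto
  have finT: "finite (T J)" for J
    unfolding T_def by (rule finite_tight_cylindric_shifted)
  \<comment> \<open>Finiteness of \<open>Y\<close> comes from that of the sets of tight tuples of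
    fixed weight, of which it contains images.\<close>
  define Y where "Y = A \<union> B \<union> (\<Union>J\<in>Pow (supp c). C J)"
  have finsupp: "finite (supp c)"
    using supp finite_subset by blast
  have finY: "finite Y"
    using finT finsupp finite_tight_cylindric_shifted[of c "\<lambda>\<sigma>. max_part \<sigma> = M" 0 m]
    by (auto simp: Y_def B_def C_def T' A_def)
  have Y: "\<pi> \<in> semi_tight c M m" if "\<pi> \<in> Y" for \<pi>
    using that A B C by (auto simp: Y_def)
  have card_ins: "card (insert_part M J ` X) = card X" for J X
    by (rule card_image[OF inj_on_subset[OF inj_insert_part]]) simp
  have "(of_nat (card A) + of_nat (card T') :: 'a) = of_nat (card A) + of_nat (card B)"
    by (simp add: B_def card_ins)
  also have "\<dots> = (\<Sum>\<pi>\<in>Y. of_bool (\<pi> \<in> A) + of_bool (\<pi> \<in> B))"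
    using card_eq_sum_of_bool[OF finY, of A, where 'a = 'a]
      card_eq_sum_of_bool[OF finY, of B, where 'a = 'a]
    by (simp add: Y_def sum.distrib Un_assoc le_supI1 le_supI2)
  also have "\<dots> = (\<Sum>\<pi>\<in>Y. \<Sum>J | J \<noteq> {} \<and> J \<subseteq> supp c. (- 1) ^ (card J - 1) * of_bool (\<pi> \<in> C J))"
  proof (rule sum.cong)
    fix \<pi> assume "\<pi> \<in> Y"
    then have \<pi>: "\<pi> \<in> semi_tight c M m" by (rule Y)
    have "(\<Sum>J | J \<noteq> {} \<and> J \<subseteq> supp c. (- 1) ^ (card J - 1) * of_bool (\<pi> \<in> C J)) =
      (\<Sum>J | J \<noteq> {} \<and> J \<subseteq> supp c. (- 1 :: 'a) ^ (card J - 1) *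
        of_bool ((\<forall>i\<in>J. ?v \<pi> i > 0) \<and> (\<exists>i<?r. ?v \<pi> i = of_bool (i \<in> J))))"
      using C \<pi> by (intro sum.cong) auto
    also have "\<dots> = of_bool ((\<exists>i<?r. ?v \<pi> i = 0) \<and> (\<exists>i<?r. ?v \<pi> i > 0)) + of_bool (\<forall>i<?r. ?v \<pi> i = 1)"
      by (rule boundary_alternating_sum[OF r supp(2,1)]) (rule count_list_rise[OF \<pi> M])
    finally show "of_bool (\<pi> \<in> A) + of_bool (\<pi> \<in> B) =
        (\<Sum>J | J \<noteq> {} \<and> J \<subseteq> supp c. (- 1 :: 'a) ^ (card J - 1) * of_bool (\<pi> \<in> C J))"
      using \<pi> by (simp add: A B)
  qed simp
  also have "\<dots> = (\<Sum>J | J \<noteq> {} \<and> J \<subseteq> supp c. (- 1) ^ (card J - 1) * (\<Sum>\<pi>\<in>Y. of_bool (\<pi> \<in> C J)))"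
    unfolding sum_distrib_left by (rule sum.swap)
  also have "\<dots> = (\<Sum>J | J \<noteq> {} \<and> J \<subseteq> supp c. (- 1) ^ (card J - 1) * of_nat (card (T J)))"
  proof (rule sum.cong)
    fix J assume "J \<in> {J. J \<noteq> {} \<and> J \<subseteq> supp c}"
    then have "C J \<subseteq> Y" by (auto simp: Y_def)
    then show "(- 1) ^ (card J - 1) * (\<Sum>\<pi>\<in>Y. of_bool (\<pi> \<in> C J)) =
        (- 1) ^ (card J - 1) * (of_nat (card (T J)) :: 'a)"
      using card_eq_sum_of_bool[OF finY, of "C J", where 'a = 'a] by (simp add: C_def card_ins)
  qed simp
  finally show ?thesis
    unfolding A_def T_def T'_def .
qed

section \<open>The constant term in z\<close>

text \<open>Parts are positive, so only the tuple of empty partitions remains. The empty profile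
  admits no tight tuple, because tightness asks for an index.\<close>

lemma tight_max_0:
  "{\<sigma> \<in> tight_cylindric c. max_part \<sigma> \<le> 0 \<and> wt \<sigma> = m} =
    (if m = 0 \<and> length c > 0 then {replicate (length c) []} else {})"
proof -
  have only: "\<sigma> = replicate (length c) []" "length c > 0" "wt \<sigma> = 0"
    if "\<sigma> \<in> tight_cylindric c" "max_part \<sigma> \<le> 0" for \<sigma>
  proof -
    have len: "length \<sigma> = length c" and pos: "\<And>i x. i < length c \<Longrightarrow> x \<in> set (\<sigma> ! i) \<Longrightarrow> x > 0"
      using that cylindric_is_partition[of c \<sigma>]
      by (auto simp: tight_cylindric_def cylindric_def is_partition_def)
    have "\<sigma> ! i = []" if "i < length c" for i
    proof -
      have False if x: "x \<in> set (\<sigma> ! i)" for x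
      proof -
        have "bounded_parts 0 \<sigma>"
          using \<open>max_part \<sigma> \<le> 0\<close> by (simp only: max_part_le_iff)
        then have "x \<le> 0"
          using x \<open>i < length c\<close> len unfolding bounded_parts_conv_nth by metis
        with pos[OF \<open>i < length c\<close> x] show False by simp
      qed
      then show ?thesis
        using last_in_set by blast
    qed
    then show eq: "\<sigma> = replicate (length c) []"
      using len by (simp add: list_eq_iff_nth_eq[of \<sigma>])
    show "wt \<sigma> = 0"
      by (simp add: eq wt_def)
    show "length c > 0"
    proof -
      have "tight \<sigma>"
        using that(1) by (simp add: tight_cylindric_def)
      from this[unfolded tight_def, rule_format, of 1] obtain i where "i < length \<sigma>"
        by auto
      then show ?thesis using len by linarith
    qed
  qed
  have max_wt: "max_part (replicate n []) \<le> 0" "wt (replicate n []) = 0" for n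
    by (simp_all only: max_part_le_iff) (simp_all add: bounded_parts_def wt_def)
  have mem: "replicate (length c) [] \<in> tight_cylindric c" if "length c > 0"
  proof -
    have "Suc i mod length c < length c" if "i < length c" for i
      using that by (rule Suc_mod_less)
    then have "cylindric c (replicate (length c) [])"
      by (simp add: cylindric_def is_partition_def part_def)
    moreover have "tight (replicate (length c) [])"
      unfolding tight_def using that by (intro allI impI exI[of _ 0]) simp
    ultimately show ?thesis
      by (simp add: tight_cylindric_def)
  qed
  have "\<sigma> \<in> tight_cylindric c \<and> max_part \<sigma> \<le> 0 \<and> wt \<sigma> = m \<longleftrightarrow>
      m = 0 \<and> length c > 0 \<and> \<sigma> = replicate (length c) []" for \<sigma>
    by (metis only mem max_wt)
  then show ?thesis
    by (auto simp del: le_zero_eq)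
qed

section \<open>Coefficients of the generating functions\<close>

text \<open>Power series in q do not form a field, so inverting a series in z rests on
  \<open>inverse\<close> of its constant coefficient. This is 1 here, and
  \<open>inverse 1 = 1\<close> does hold in \<open>rat fps\<close>.\<close>

lemma one_minus_mult_inverse:
  fixes a :: "'a::{comm_ring_1,inverse}"
  assumes "inverse (1::'a) = 1"
  shows "(1 - fps_X * fps_const a) * inverse (1 - fps_X * fps_const a) = 1"
  unfolding fps_inverse_def by (rule fps_right_inverse) (simp add: assms)

lemma div_one_minus:
  fixes a :: "'a::{comm_ring_1,inverse}"
  assumes "inverse (1::'a) = 1"
  shows "f / (1 - fps_X * fps_const a) = f * inverse (1 - fps_X * fps_const a)"
  by (rule fps_divide_unit) simp

text \<open>In the variable x = az, dividing by 1 - x replaces coefficients by partial sums. This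
  turns maximum equal to \<open>M\<close> into maximum at most \<open>M\<close>.\<close>

lemma compose_div_one_minus:
  fixes f :: "'a::{comm_ring_1,inverse} fps"
  assumes "inverse (1::'a) = 1"
  shows "(f oo (fps_X * fps_const a)) / (1 - fps_X * fps_const a) =
    Abs_fps (\<lambda>n. a ^ n * (\<Sum>i\<le>n. f $ i))"
proof -
  let ?d = "1 - fps_X * fps_const a"
  define g where "g = Abs_fps (\<lambda>n. a ^ n * (\<Sum>i\<le>n. f $ i))"
  have "f oo (fps_X * fps_const a) = g * ?d"
  proof (rule fps_ext)
    fix n
    have "(f oo (fps_X * fps_const a)) $ n = a ^ n * f $ n"
      unfolding mult.commute[of fps_X "fps_const a"] by (rule fps_nth_compose_linear)
    moreover have "g * ?d = g - fps_X * (fps_const a * g)"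
      by (simp add: right_diff_distrib mult_ac)
    ultimately show "(f oo (fps_X * fps_const a)) $ n = (g * ?d) $ n"
      by (cases n) (simp_all add: g_def distrib_left mult.assoc)
  qed
  then show ?thesis
    using one_minus_mult_inverse[OF assms, of a]
    by (simp add: div_one_minus[OF assms] mult.assoc g_def)
qed

lemma qvar_power: "qvar ^ k = fps_const (fps_X ^ k)"
  by simp

lemma T_gf_partial_sum_nth:
  "((\<Sum>i\<le>M. T_gf c $ i) :: rat fps) $ m = of_nat (card {\<sigma> \<in> tight_cylindric c. max_part \<sigma> \<le> M \<and> wt \<sigma> = m})"
proof -
  have "{\<sigma> \<in> tight_cylindric c. max_part \<sigma> \<le> M \<and> wt \<sigma> = m} =
      (\<Union>i\<le>M. {\<sigma> \<in> tight_cylindric c. max_part \<sigma> = i \<and> wt \<sigma> = m})"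
    by auto
  moreover have "finite {\<sigma> \<in> tight_cylindric c. max_part \<sigma> = i \<and> wt \<sigma> = m}" for i
    by (rule finite_subset[OF _ finite_tight_cylindric_wt[of c m]]) auto
  ultimately have "card {\<sigma> \<in> tight_cylindric c. max_part \<sigma> \<le> M \<and> wt \<sigma> = m} =
      (\<Sum>i\<le>M. card {\<sigma> \<in> tight_cylindric c. max_part \<sigma> = i \<and> wt \<sigma> = m})"
    by (simp add: card_UN_disjoint disjoint_iff)
  then show ?thesis
    by (simp add: T_gf_def fps_sum_nth)
qed

text \<open>With a = q^k the factor a^M shifts the weight by \<open>M * k\<close>. The additive form
  of the shift yields 0 when \<open>m < M * k\<close>.\<close>

lemma T_gf_compose_div_nth:
  "((T_gf c oo (zvar * qvar ^ k)) / (1 - zvar * qvar ^ k)) $ M $ m =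
    of_nat (card {\<sigma> \<in> tight_cylindric c. max_part \<sigma> \<le> M \<and> wt \<sigma> + M * k = m})"
proof -
  have "{\<sigma> \<in> tight_cylindric c. max_part \<sigma> \<le> M \<and> wt \<sigma> + M * k = m} =
      (if m < M * k then {} else {\<sigma> \<in> tight_cylindric c. max_part \<sigma> \<le> M \<and> wt \<sigma> = m - M * k})"
    by auto
  then show ?thesis
    unfolding qvar_power
    by (subst compose_div_one_minus)
      (simp_all add: power_mult[symmetric] fps_X_power_mult_nth T_gf_partial_sum_nth mult.commute
        del: fps_const_power)
qed

text \<open>The extra factor z q^k leads from (M, m) to (M - 1, m - k): the bound becomes strict,
  and the total weight shift (M - 1) k + k is again M k.\<close>

lemma T_gf_mult_compose_div_nth:
  "(zvar * qvar ^ k / (1 - zvar * qvar ^ k) * (T_gf c oo (zvar * qvar ^ k))) $ M $ m =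
    of_nat (card {\<sigma> \<in> tight_cylindric c. max_part \<sigma> < M \<and> wt \<sigma> + M * k = m})"
proof -
  define E where "E = (T_gf c oo (zvar * qvar ^ k)) / (1 - zvar * qvar ^ k)"
  have "zvar * qvar ^ k / (1 - zvar * qvar ^ k) * (T_gf c oo (zvar * qvar ^ k)) =
      fps_X * (fps_const (fps_X ^ k) * E)"
    unfolding E_def qvar_power
    by (subst (1 2) div_one_minus) (simp_all add: mult_ac del: fps_const_power)
  then have eq: "(zvar * qvar ^ k / (1 - zvar * qvar ^ k) * (T_gf c oo (zvar * qvar ^ k))) $ M $ m =
      (if M = 0 \<or> m < k then 0 else E $ (M - 1) $ (m - k))"
    by (simp add: fps_X_power_mult_nth)
  show ?thesis
  proof (cases "M = 0 \<or> m < k")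
    case True
    then have empty: "{\<sigma> \<in> tight_cylindric c. max_part \<sigma> < M \<and> wt \<sigma> + M * k = m} = {}"
      by (cases M) auto
    show ?thesis
      unfolding eq empty using True by simp
  next
    case False
    then have set_eq: "{\<sigma> \<in> tight_cylindric c. max_part \<sigma> < M \<and> wt \<sigma> + M * k = m} =
        {\<sigma> \<in> tight_cylindric c. max_part \<sigma> \<le> M - 1 \<and> wt \<sigma> + (M - 1) * k = m - k}"
      by (cases M) auto
    show ?thesis
      unfolding eq set_eq if_not_P[OF False] E_def by (rule T_gf_compose_div_nth)
  qed
qed

lemma sign_mult_nth: "((- 1) ^ k * f) $ M $ m = (- 1) ^ k * (f $ M $ m)" for f :: "rat fps fps"
  by (cases "even k") auto

theorem theorem10:
  fixes c :: "nat list" and r :: nat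
  assumes "length c = r" and "r \<ge> 2" and "sum_list c \<ge> 1"
  shows "T_gf c + zvar * qvar ^ r / (1 - zvar * qvar ^ r) * (T_gf c oo (zvar * qvar ^ r)) =
    (\<Sum>J | J \<noteq> {} \<and> J \<subseteq> supp c.
       (- 1) ^ (card J - 1) *
       ((T_gf (shift_profile c J) oo (zvar * qvar ^ card J)) / (1 - zvar * qvar ^ card J)))"
    (is "?lhs = ?rhs")
proof (rule fps_ext, rule fps_ext)
  fix M m
  have lhs: "?lhs $ M $ m =
      of_nat (card {\<pi> \<in> tight_cylindric c. max_part \<pi> = M \<and> wt \<pi> = m}) +
      of_nat (card {\<sigma> \<in> tight_cylindric c. max_part \<sigma> < M \<and> wt \<sigma> + M * r = m})"
    unfolding fps_add_nth T_gf_mult_compose_div_nth by (simp add: T_gf_def)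
  have rhs: "?rhs $ M $ m = (\<Sum>J | J \<noteq> {} \<and> J \<subseteq> supp c. (- 1) ^ (card J - 1) *
      of_nat (card {\<sigma> \<in> tight_cylindric (shift_profile c J).
         max_part \<sigma> \<le> M \<and> wt \<sigma> + M * card J = m}))"
    unfolding fps_sum_nth sign_mult_nth T_gf_compose_div_nth ..
  show "?lhs $ M $ m = ?rhs $ M $ m"
  proof (cases "M = 0")
    case True
    have fin: "finite (supp c)"
      by (simp add: supp_def)
    \<comment> \<open>Every \<open>J\<close> contributes the empty tuple once, and the signs over
      the nonempty subsets of the support sum to 1.\<close>
    have "?rhs $ M $ m = (\<Sum>J | J \<noteq> {} \<and> J \<subseteq> supp c. (- 1) ^ (card J - 1)) * of_bool (m = 0)"
      unfolding rhs sum_distrib_right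
      using True assms tight_max_0[of "shift_profile c _" m] by (intro sum.cong) auto
    also have "\<dots> = of_bool (m = 0)"
      using sum_nonempty_subsets_alternating[OF fin, where 'a = rat] supp_nonempty[OF assms(3)] by simp
    finally show ?thesis
      unfolding lhs using True assms tight_max_0[of c m] by auto
  next
    case False
    then show ?thesis
      unfolding lhs rhs using card_identity[of M c m, where 'a = rat] assms by simp
  qed
qed

end
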